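(* Let $\delta>0$. Suppose that each quaternion matrix $\mathscr F_s(\boldsymbol{\mathcal X}_t)\in\mathbb Q^{(wh)\times d_s}$ generated by the 2DQPCA-based classification procedure (described in the context) satisfies $\|\widehat{\mathbf P}_k-\mathbf P_s\|_F\le\frac{\sqrt2}{2}\delta$ (for the projections $\widehat{\mathbf P}_k$ of the patches gathered in the $s$-th class) and has the singular value decomposition $$\mathscr F_s(\boldsymbol{\mathcal X}_t)=\mathbf U\Sigma\mathbf V^*,$$ where $\Sigma=\operatorname{diag}(\sigma_1,\dots,\sigma_{d_s})$, $\sigma_1\ge\cdots\ge\sigma_{d_s}\ge0$, and $\mathbf V=[\mathbf v_1,\dots,\mathbf v_{d_s}]$. Let $r\ (\le d_s)$ be the least positive integer such that $$\sum_{k=1}^{r-1}(\sigma_k^2-\sigma_r^2)|\mathbf w_k|^2\ \ge\ \sum_{k=r+1}^{d_s}(\sigma_r^2-\sigma_k^2)|\mathbf w_k|^2 ,$$ where $[\mathbf w_1,\dots,\mathbf w_{d_s}]^T=\mathbf v_i-\mathbf v_j$ (with $i\ne j$). Then $\sigma_r\le\delta$, and thus the $\delta$-rank of $\mathscr F_s(\boldsymbol{\mathcal X}_t)$ is less than $r$.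
   Context: $\mathbb Q$ denotes the quaternions; $\|\cdot\|_F$ is the Frobenius norm. $\delta$-rank: a quaternion matrix $\mathbf A$ is called of $\delta$-rank $r$ if it has $r$ singular values bigger than $\delta>0$. 2DQPCA-based classification procedure. Input: a set $\mathcal G_t$ of $n$ quaternion matrices ("patches") of size $w\times h$, taken from the part $\boldsymbol{\mathcal X}_t$ of a quaternion tensor in a fixed window. Choose $\ell$ of them as exemplar patches $\mathbf E_1,\dots,\mathbf E_\ell$, and denote the remaining patches by $\mathbf Y_1,\dots,\mathbf Y_{n-\ell}$. Let $\Psi=\frac1\ell\sum_{s=1}^\ell\mathbf E_s$, $\Phi_s=\mathbf E_s-\Psi$, and $\mathbf C=\frac1{\ell-1}\sum_{s=1}^\ell\Phi_s^*\Phi_s\in\mathbb Q^{h\times h}$. Let $\mathbf W\in\mathbb Q^{h\times h}$ be the matrix whose columns are the $h$ (orthonormal) eigenvectors of $\mathbf C$. Compute the projections $\mathbf P_s=\Phi_s\mathbf W$ for $s=1,\dots,\ell$ and $\widehat{\mathbf P}_k=(\mathbf Y_k-\Psi)\mathbf W$ for $k=1,\dots,n-\ell$. For each $k$ let $y(k)=\arg\min_{1\le s\le\ell}\|\widehat{\mathbf P}_k-\mathbf P_s\|_F$. The $s$-th class $\hat{\mathcal G}_s$ gathers the patches $\mathbf Y_k$ with $y(k)=s$; let $d_s=|\hat{\mathcal G}_s|$. Finally $\mathscr F_s(\boldsymbol{\mathcal X}_t)\in\mathbb Q^{(wh)\times d_s}$ is the matrix whose columns are the vectorizations (stacked columns)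 of the patches in $\hat{\mathcal G}_s$.
   Formalization: The vectors v_i are taken to be the columns of V* (conjugated rows of V) instead of the columns of V; with columns of V the claim fails, e.g. for F with columns (10,1/2), (10,-1/2) and δ=1, where r=1 but σ_1=10√2. *)

theory Defs
  imports
    Complex_Main
    "HOL-Library.Multiset"
    "HOL-Analysis.Inner_Product"
    "Jordan_Normal_Form.Matrix"
begin

section \<open>Quaternions\<close>

datatype quat = Quat (qre: real) (qi: real) (qj: real) (qk: real)

lemma quat_eq_iff:
  "x = y \<longleftrightarrow> qre x = qre y \<and> qi x = qi y \<and> qj x = qj y \<and> qk x = qk y"
  by (cases x; cases y) simp

instantiation quat :: real_vector
begin

definition "0 = Quat 0 0 0 0"

definition "x + y = Quat (qre x + qre y) (qi x + qi y) (qj x + qj y) (qk x + qk y)"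

definition "- x = Quat (- qre x) (- qi x) (- qj x) (- qk x)"

definition "x - y = Quat (qre x - qre y) (qi x - qi y) (qj x - qj y) (qk x - qk y)"

definition "c *\<^sub>R x = Quat (c * qre x) (c * qi x) (c * qj x) (c * qk x)"

instance
  by standard
    (simp_all add: zero_quat_def plus_quat_def uminus_quat_def minus_quat_def scaleR_quat_def
      quat_eq_iff algebra_simps)

end

instantiation quat :: real_inner
begin

definition inner_quat :: "quat \<Rightarrow> quat \<Rightarrow> real" where
  "inner_quat x y = qre x * qre y + qi x * qi y + qj x * qj y + qk x * qk y"

definition norm_quat :: "quat \<Rightarrow> real" where
  "norm_quat x = sqrt ((qre x)\<^sup>2 + (qi x)\<^sup>2 + (qj x)\<^sup>2 + (qk x)\<^sup>2)"

definition sgn_quat :: "quat \<Rightarrow> quat" where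
  "sgn_quat x = x /\<^sub>R norm x"

definition dist_quat :: "quat \<Rightarrow> quat \<Rightarrow> real" where
  "dist_quat x y = norm (x - y)"

definition uniformity_quat :: "(quat \<times> quat) filter" where
  "uniformity_quat = (INF e\<in>{0 <..}. principal {(x, y). dist x y < e})"

definition open_quat :: "quat set \<Rightarrow> bool" where
  "open_quat S \<longleftrightarrow> (\<forall>x\<in>S. eventually (\<lambda>(x', y). x' = x \<longrightarrow> y \<in> S) uniformity)"

instance
proof
  fix x y z :: quat and r s :: real
  show "(0 \<le> inner x x)" by (simp add: inner_quat_def)
  have sq: "a * a + b * b + c * c + d * d = 0 \<longleftrightarrow> a = 0 \<and> b = 0 \<and> c = 0 \<and> d = 0"
    for a b c d :: real
    by (auto simp: add_nonneg_eq_0_iff)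
  show "(inner x x = 0) = (x = 0)"
    by (simp add: inner_quat_def zero_quat_def quat_eq_iff sq)
  show "norm x = sqrt (inner x x)"
    by (simp add: inner_quat_def norm_quat_def power2_eq_square)
qed (simp_all add: zero_quat_def plus_quat_def uminus_quat_def minus_quat_def scaleR_quat_def
      inner_quat_def sgn_quat_def dist_quat_def uniformity_quat_def open_quat_def algebra_simps)

end

lemma quat_sel_simps [simp]:
  "qre 0 = 0" "qi 0 = 0" "qj 0 = 0" "qk 0 = 0"
  "qre (x + y) = qre x + qre y" "qi (x + y) = qi x + qi y"
  "qj (x + y) = qj x + qj y" "qk (x + y) = qk x + qk y"
  "qre (- x) = - qre x" "qi (- x) = - qi x" "qj (- x) = - qj x" "qk (- x) = - qk x"
  "qre (x - y) = qre x - qre y" "qi (x - y) = qi x - qi y"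
  "qj (x - y) = qj x - qj y" "qk (x - y) = qk x - qk y"
  "qre (c *\<^sub>R x) = c * qre x" "qi (c *\<^sub>R x) = c * qi x"
  "qj (c *\<^sub>R x) = c * qj x" "qk (c *\<^sub>R x) = c * qk x"
  by (simp_all add: zero_quat_def plus_quat_def uminus_quat_def minus_quat_def scaleR_quat_def)

instantiation quat :: "{real_normed_div_algebra, conjugate}"
begin

definition "1 = Quat 1 0 0 0"

definition "x * y = Quat
  (qre x * qre y - qi x * qi y - qj x * qj y - qk x * qk y)
  (qre x * qi y + qi x * qre y + qj x * qk y - qk x * qj y)
  (qre x * qj y - qi x * qk y + qj x * qre y + qk x * qi y)
  (qre x * qk y + qi x * qj y - qj x * qi y + qk x * qre y)"

definition conjugate_quat :: "quat \<Rightarrow> quat" where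
  "conjugate_quat x = Quat (qre x) (- qi x) (- qj x) (- qk x)"

definition inverse_quat :: "quat \<Rightarrow> quat" where
  "inverse_quat x = conjugate x /\<^sub>R (norm x)\<^sup>2"

definition divide_quat :: "quat \<Rightarrow> quat \<Rightarrow> quat" where
  "divide_quat x y = x * inverse y"

instance
proof
  fix a b x y :: quat and r :: real
  have nsq: "(norm a)\<^sup>2 = (qre a)\<^sup>2 + (qi a)\<^sup>2 + (qj a)\<^sup>2 + (qk a)\<^sup>2" for a :: quat
    by (simp add: norm_quat_def)
  have nsq2: "norm a * norm a = qre a * qre a + qi a * qi a + qj a * qj a + qk a * qk a"
    for a :: quat
    using nsq[of a] by (simp add: power2_eq_square)
  have c1: "conjugate a * a = (norm a)\<^sup>2 *\<^sub>R 1"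
    by (simp add: quat_eq_iff times_quat_def conjugate_quat_def one_quat_def power2_eq_square
        nsq2 algebra_simps)
  have c2: "a * conjugate a = (norm a)\<^sup>2 *\<^sub>R 1"
    by (simp add: quat_eq_iff times_quat_def conjugate_quat_def one_quat_def power2_eq_square
        nsq2 algebra_simps)
  have sl: "(r *\<^sub>R x) * y = r *\<^sub>R (x * y)" for r and x y :: quat
    by (simp add: quat_eq_iff times_quat_def algebra_simps)
  have sr: "x * (r *\<^sub>R y) = r *\<^sub>R (x * y)" for r and x y :: quat
    by (simp add: quat_eq_iff times_quat_def algebra_simps)
  show "a \<noteq> 0 \<Longrightarrow> inverse a * a = 1"
    by (simp add: inverse_quat_def sl c1)
  show "a \<noteq> 0 \<Longrightarrow> a * inverse a = 1"
    by (simp add: inverse_quat_def sr c2)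
  show "inverse (0::quat) = 0"
    by (simp add: inverse_quat_def)
  have "(norm (x * y))\<^sup>2 = (norm x * norm y)\<^sup>2"
    unfolding power_mult_distrib nsq
    by (simp add: times_quat_def power2_eq_square algebra_simps)
  then show "norm (x * y) = norm x * norm y"
    by (simp add: power2_eq_iff_nonneg)
qed (simp_all add: quat_eq_iff times_quat_def one_quat_def conjugate_quat_def divide_quat_def
      algebra_simps)

end


section \<open>Quaternion matrices\<close>

definition qadjoint :: "quat mat \<Rightarrow> quat mat" where
  "qadjoint A = map_mat conjugate (A\<^sup>T)"

definition qunitary :: "nat \<Rightarrow> quat mat \<Rightarrow> bool" where
  "qunitary n U \<longleftrightarrow>
     U \<in> carrier_mat n n \<and> qadjoint U * U = 1\<^sub>m n \<and> U * qadjoint U = 1\<^sub>m n"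

definition frob_norm :: "quat mat \<Rightarrow> real" where
  "frob_norm A = sqrt (\<Sum>i<dim_row A. \<Sum>j<dim_col A. (norm (A $$ (i, j)))\<^sup>2)"

text \<open>Over the quaternions an eigenvector is a right eigenvector: \<open>C v = v \<mu>\<close>.\<close>

definition qeigenvector :: "quat mat \<Rightarrow> quat vec \<Rightarrow> bool" where
  "qeigenvector C v \<longleftrightarrow>
     v \<in> carrier_vec (dim_row C) \<and> v \<noteq> 0\<^sub>v (dim_row C) \<and>
     (\<exists>\<mu>. C *\<^sub>v v = vec (dim_row C) (\<lambda>i. v $ i * \<mu>))"

text \<open>
  The singular values are numbered from 1, matrix entries from 0. The diagonal factor of an
  \<open>m \<times> n\<close> matrix is \<open>m \<times> n\<close>, and exactly \<open>n\<close> numbers \<open>\<sigma> 1, \<dots>, \<sigma> n\<close> are listed; when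
  \<open>n > m\<close> the last \<open>n - m\<close> of them do not occur on the diagonal and are 0 by convention.
\<close>

definition qsvd :: "quat mat \<Rightarrow> quat mat \<Rightarrow> (nat \<Rightarrow> real) \<Rightarrow> quat mat \<Rightarrow> bool" where
  "qsvd A U \<sigma> V \<longleftrightarrow>
     (let m = dim_row A; n = dim_col A;
          \<Sigma> = mat m n (\<lambda>(i, j). if i = j then of_real (\<sigma> (i + 1)) else 0)
      in qunitary m U \<and> qunitary n V \<and> A = U * \<Sigma> * qadjoint V \<and>
         (\<forall>k\<in>{1..n}. \<forall>l\<in>{1..n}. k \<le> l \<longrightarrow> \<sigma> l \<le> \<sigma> k) \<and>
         (\<forall>k\<in>{1..n}. 0 \<le> \<sigma> k) \<and>
         (\<forall>k\<in>{1..n}. m < k \<longrightarrow> \<sigma> k = 0))"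

definition singular_values :: "quat mat \<Rightarrow> real multiset" where
  "singular_values A =
     (THE S. \<exists>U \<sigma> V. qsvd A U \<sigma> V \<and>
        S = image_mset \<sigma> (mset_set {1..min (dim_row A) (dim_col A)}))"

definition delta_rank :: "real \<Rightarrow> quat mat \<Rightarrow> nat" where
  "delta_rank \<delta> A = size (filter_mset (\<lambda>x. \<delta> < x) (singular_values A))"


section \<open>The 2DQPCA-based classification procedure\<close>

text \<open>
  \<open>E\<close> lists the exemplar patches (indices \<open>1..L\<close>) and \<open>Y\<close> the remaining ones
  (indices \<open>1..n - L\<close>); all patches have size \<open>w \<times> h\<close>.
\<close>

definition exemplar_mean :: "nat \<Rightarrow> nat \<Rightarrow> nat \<Rightarrow> (nat \<Rightarrow> quat mat) \<Rightarrow> quat mat" where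
  "exemplar_mean w h L E =
     mat w h (\<lambda>(i, j). (1 / real L) *\<^sub>R (\<Sum>s = 1..L. E s $$ (i, j)))"

definition exemplar_cov :: "nat \<Rightarrow> nat \<Rightarrow> nat \<Rightarrow> (nat \<Rightarrow> quat mat) \<Rightarrow> quat mat" where
  "exemplar_cov w h L E =
     (let \<Phi> = (\<lambda>s. E s - exemplar_mean w h L E)
      in mat h h (\<lambda>(i, j). (1 / (real L - 1)) *\<^sub>R
           (\<Sum>s = 1..L. (qadjoint (\<Phi> s) * \<Phi> s) $$ (i, j))))"

definition projection ::
  "nat \<Rightarrow> nat \<Rightarrow> nat \<Rightarrow> (nat \<Rightarrow> quat mat) \<Rightarrow> quat mat \<Rightarrow> quat mat \<Rightarrow> quat mat" where
  "projection w h L E W A = (A - exemplar_mean w h L E) * W"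

text \<open>
  The input is a multiset, since patches at different positions may coincide. The choices which
  the procedure leaves open (exemplars, eigenvectors, ties in the minimisation) are parameters.
\<close>

definition classification_2dqpca ::
  "nat \<Rightarrow> nat \<Rightarrow> nat \<Rightarrow> nat \<Rightarrow> quat mat multiset \<Rightarrow> (nat \<Rightarrow> quat mat) \<Rightarrow> (nat \<Rightarrow> quat mat) \<Rightarrow>
     quat mat \<Rightarrow> (nat \<Rightarrow> nat) \<Rightarrow> bool" where
  "classification_2dqpca w h n L \<G> E Y W y \<longleftrightarrow>
     size \<G> = n \<and> (\<forall>A\<in>#\<G>. A \<in> carrier_mat w h) \<and>
     2 \<le> L \<and> L \<le> n \<and>
     \<G> = image_mset E (mset_set {1..L}) + image_mset Y (mset_set {1..n - L}) \<and>
     W \<in> carrier_mat h h \<and> qadjoint W * W = 1\<^sub>m h \<and>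
     (\<forall>j<h. qeigenvector (exemplar_cov w h L E) (col W j)) \<and>
     (\<forall>k\<in>{1..n - L}.
        is_arg_min
          (\<lambda>s. frob_norm (projection w h L E W (Y k) - projection w h L E W (E s)))
          (\<lambda>s. s \<in> {1..L}) (y k))"

definition class_indices :: "nat \<Rightarrow> nat \<Rightarrow> (nat \<Rightarrow> nat) \<Rightarrow> nat \<Rightarrow> nat set" where
  "class_indices n L y s = {k \<in> {1..n - L}. y k = s}"

definition vectorize :: "quat mat \<Rightarrow> quat vec" where
  "vectorize A =
     vec (dim_row A * dim_col A) (\<lambda>i. A $$ (i mod dim_row A, i div dim_row A))"

definition class_matrix ::
  "nat \<Rightarrow> nat \<Rightarrow> nat \<Rightarrow> nat \<Rightarrow> (nat \<Rightarrow> quat mat) \<Rightarrow> (nat \<Rightarrow> nat) \<Rightarrow> nat \<Rightarrow> quat mat" where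
  "class_matrix w h n L Y y s =
     mat_of_cols (w * h)
       (map (\<lambda>k. vectorize (Y k)) (sorted_list_of_set (class_indices n L y s)))"


section \<open>The index condition\<close>

text \<open>
  \<open>v i\<close> is the \<open>i\<close>-th column of \<open>V\<^sup>*\<close> (the conjugate of the \<open>i\<close>-th row of \<open>V\<close>), so that
  the columns \<open>x\<^sub>i\<close> of \<open>F = U \<Sigma> V\<^sup>*\<close> satisfy \<open>x\<^sub>i - x\<^sub>j = U \<Sigma> (v i - v j)\<close>. With the columns
  of \<open>V\<close> itself the result fails: let \<open>F\<close> have columns \<open>(10, 1/2)\<close> and \<open>(10, -1/2)\<close>,
  \<open>U = diag(1, -1)\<close>, \<open>V\<close> with columns \<open>(1, 1)/\<surd>2\<close> and \<open>(-1, 1)/\<surd>2\<close>, and \<open>\<delta> = 1\<close>.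
  The difference of the two columns of \<open>V\<close> is \<open>(\<surd>2, 0)\<close>, so the condition holds at \<open>r = 1\<close>,
  while \<open>\<sigma> 1 = 10 \<surd>2\<close>.
\<close>

definition difference_vec :: "quat mat \<Rightarrow> nat \<Rightarrow> nat \<Rightarrow> quat vec" where
  "difference_vec V i j = col (qadjoint V) (i - 1) - col (qadjoint V) (j - 1)"

definition index_condition :: "(nat \<Rightarrow> real) \<Rightarrow> quat vec \<Rightarrow> nat \<Rightarrow> nat \<Rightarrow> bool" where
  "index_condition \<sigma> v d r \<longleftrightarrow>
     (\<Sum>k = 1..r - 1. ((\<sigma> k)\<^sup>2 - (\<sigma> r)\<^sup>2) * (norm (v $ (k - 1)))\<^sup>2) \<ge>
     (\<Sum>k = r + 1..d. ((\<sigma> r)\<^sup>2 - (\<sigma> k)\<^sup>2) * (norm (v $ (k - 1)))\<^sup>2)"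

end

theory Submission
  imports Defs
begin

text \<open>
  Right multiplication by the unitary \<open>W\<close> preserves the Frobenius norm, so any two patches of the
  \<open>s\<close>-th class are at squared distance at most \<open>2 \<delta>\<^sup>2\<close>. With \<open>w = v\<^sub>i - v\<^sub>j\<close> this squared
  distance is \<open>\<Sum>\<^sub>k \<sigma>\<^sub>k\<^sup>2 |w\<^sub>k|\<^sup>2\<close>, while \<open>\<Sum>\<^sub>k |w\<^sub>k|\<^sup>2 = 2\<close>, and the index condition says that
  the former is at least \<open>2 \<sigma>\<^sub>r\<^sup>2\<close>.

  For the \<open>\<delta>\<close>-rank one needs that singular values are unique. If \<open>A\<^sup>* A\<close> is diagonalised by
  unitary \<open>V\<close> and \<open>V'\<close>, then \<open>Q = V\<^sup>* V'\<close> is unitary with \<open>Q\<^sub>k\<^sub>l = 0\<close> unless \<open>\<sigma>\<^sub>k = \<sigma>'\<^sub>l\<close>;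
  summing \<open>|Q\<^sub>k\<^sub>l|\<^sup>2\<close> over the block belonging to one value, by rows and by columns, shows that
  this value has the same multiplicity in both decompositions.
\<close>

section \<open>Adjoints and the Frobenius norm\<close>

lemma conjugate_quat_sel [simp]:
  "qre (conjugate x) = qre x" "qi (conjugate x) = - qi x"
  "qj (conjugate x) = - qj x" "qk (conjugate x) = - qk x"
  by (simp_all add: conjugate_quat_def)

lemma quat_one_sel [simp]: "qre 1 = 1" "qi 1 = 0" "qj 1 = 0" "qk 1 = 0"
  by (simp_all add: one_quat_def)

lemma conjugate_quat_mult: "conjugate (x * y) = conjugate y * conjugate (x :: quat)"
  by (simp add: quat_eq_iff times_quat_def)

lemma conjugate_quat_add: "conjugate (x + y) = conjugate x + conjugate (y :: quat)"
  by (simp add: quat_eq_iff)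

lemma conjugate_quat_minus: "conjugate (x - y) = conjugate x - conjugate (y :: quat)"
  by (simp add: quat_eq_iff)

lemma conjugate_quat_0 [simp]: "conjugate (0 :: quat) = 0"
  by (simp add: quat_eq_iff)

lemma conjugate_quat_1 [simp]: "conjugate (1 :: quat) = 1"
  by (simp add: quat_eq_iff)

lemma conjugate_quat_conjugate [simp]: "conjugate (conjugate x) = (x :: quat)"
  by (simp add: quat_eq_iff)

lemma conjugate_quat_of_real [simp]: "conjugate (of_real c :: quat) = of_real c"
  by (simp add: quat_eq_iff of_real_def)

lemma conjugate_quat_sum: "conjugate (sum f A) = (\<Sum>x\<in>A. conjugate (f x :: quat))"
  by (induction A rule: infinite_finite_induct) (simp_all add: conjugate_quat_add)

lemma qre_sum: "qre (sum f A) = (\<Sum>x\<in>A. qre (f x))"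
  by (induction A rule: infinite_finite_induct) simp_all

lemma norm_quat_sq: "(norm x)\<^sup>2 = (qre x)\<^sup>2 + (qi x)\<^sup>2 + (qj x)\<^sup>2 + (qk x)\<^sup>2"
  by (simp add: norm_quat_def)

lemma qre_conjugate_mult: "qre (conjugate x * x) = (norm x)\<^sup>2" "qre (x * conjugate x) = (norm x)\<^sup>2"
  unfolding norm_quat_sq by (simp_all add: times_quat_def power2_eq_square)

section \<open>Adjoints and matrix products\<close>

lemma dim_qadjoint [simp]: "dim_row (qadjoint A) = dim_col A" "dim_col (qadjoint A) = dim_row A"
  by (simp_all add: qadjoint_def)

lemma qadjoint_carrier [simp, intro]: "A \<in> carrier_mat m n \<Longrightarrow> qadjoint A \<in> carrier_mat n m"
  by (simp add: qadjoint_def)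

lemma qadjoint_index [simp]:
  "i < dim_col A \<Longrightarrow> j < dim_row A \<Longrightarrow> qadjoint A $$ (i, j) = conjugate (A $$ (j, i))"
  by (simp add: qadjoint_def)

lemma qadjoint_qadjoint [simp]: "qadjoint (qadjoint A) = A"
  by (rule eq_matI) simp_all

lemma mult_mat_index_sum:
  "A \<in> carrier_mat m p \<Longrightarrow> B \<in> carrier_mat p n \<Longrightarrow> i < m \<Longrightarrow> j < n \<Longrightarrow>
    (A * B) $$ (i, j) = (\<Sum>k<p. A $$ (i, k) * B $$ (k, j))"
  by (auto simp: scalar_prod_def atLeast0LessThan intro!: sum.cong)

lemma qadjoint_mult:
  assumes "A \<in> carrier_mat m p" "B \<in> carrier_mat p n"
  shows "qadjoint (A * B) = qadjoint B * qadjoint A"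
proof (rule eq_matI)
  fix i j assume "i < dim_row (qadjoint B * qadjoint A)" "j < dim_col (qadjoint B * qadjoint A)"
  then have ij: "i < n" "j < m" using assms by auto
  have "qadjoint (A * B) $$ (i, j) = conjugate (\<Sum>k<p. A $$ (j, k) * B $$ (k, i))"
    using assms ij by (simp add: mult_mat_index_sum[OF assms] del: index_mult_mat(1))
  also have "\<dots> = (\<Sum>k<p. qadjoint B $$ (i, k) * qadjoint A $$ (k, j))"
    unfolding conjugate_quat_sum using assms ij
    by (intro sum.cong) (auto simp: conjugate_quat_mult)
  also have "\<dots> = (qadjoint B * qadjoint A) $$ (i, j)"
    using mult_mat_index_sum[OF qadjoint_carrier[OF assms(2)] qadjoint_carrier[OF assms(1)] ij]
    by simp
  finally show "qadjoint (A * B) $$ (i, j) = (qadjoint B * qadjoint A) $$ (i, j)" .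
qed (use assms in auto)

section \<open>The Frobenius norm and its invariance under isometries\<close>

lemma frob_norm_sq:
  "A \<in> carrier_mat m n \<Longrightarrow> (frob_norm A)\<^sup>2 = (\<Sum>i<m. \<Sum>j<n. (norm (A $$ (i, j)))\<^sup>2)"
  by (auto simp: frob_norm_def sum_nonneg)

text \<open>A diagonal entry of the Gram matrix \<open>qadjoint A * A\<close> is the squared length
  of a column. Equal Gram matrices therefore give equal norms.\<close>

lemma frob_norm_sq_col:
  assumes "A \<in> carrier_mat m n"
  shows "(frob_norm A)\<^sup>2 = (\<Sum>j<n. qre ((qadjoint A * A) $$ (j, j)))"
proof -
  have "(frob_norm A)\<^sup>2 = (\<Sum>j<n. \<Sum>i<m. (norm (A $$ (i, j)))\<^sup>2)"
    unfolding frob_norm_sq[OF assms] by (rule sum.swap)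
  also have "\<dots> = (\<Sum>j<n. qre ((qadjoint A * A) $$ (j, j)))"
    using assms
    by (intro sum.cong refl)
       (auto simp: mult_mat_index_sum[OF qadjoint_carrier[OF assms] assms] qre_sum
         qre_conjugate_mult simp del: index_mult_mat(1))
  finally show ?thesis .
qed

lemma frob_norm_qadjoint:
  assumes "A \<in> carrier_mat m n"
  shows "(frob_norm (qadjoint A))\<^sup>2 = (frob_norm A)\<^sup>2"
proof -
  have nc: "norm (conjugate x) = norm x" for x :: quat by (simp add: norm_quat_def)
  have "(frob_norm (qadjoint A))\<^sup>2 = (\<Sum>j<n. \<Sum>i<m. (norm (A $$ (i, j)))\<^sup>2)"
    unfolding frob_norm_sq[OF qadjoint_carrier[OF assms]] using assms
    by (intro sum.cong refl) (auto simp: nc)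
  also have "\<dots> = (frob_norm A)\<^sup>2"
    unfolding frob_norm_sq[OF assms] by (rule sum.swap)
  finally show ?thesis .
qed

text \<open>The Gram matrices of \<open>Q * A\<close> and \<open>A\<close> coincide, because
  \<open>qadjoint Q * Q\<close> cancels in the middle.\<close>

lemma frob_norm_isometry_mult:
  assumes "Q \<in> carrier_mat m p" "A \<in> carrier_mat p n" "qadjoint Q * Q = 1\<^sub>m p"
  shows "(frob_norm (Q * A))\<^sup>2 = (frob_norm A)\<^sup>2"
proof -
  note ca = qadjoint_carrier[OF assms(1)] qadjoint_carrier[OF assms(2)]
  have "qadjoint (Q * A) * (Q * A) = qadjoint A * (qadjoint Q * (Q * A))"
    unfolding qadjoint_mult[OF assms(1,2)]
    by (rule assoc_mult_mat[OF ca(2,1)]) (use assms in auto)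
  also have "qadjoint Q * (Q * A) = qadjoint Q * Q * A"
    by (rule assoc_mult_mat[OF ca(1) assms(1,2), symmetric])
  also have "\<dots> = A" using assms by simp
  finally show ?thesis
    using frob_norm_sq_col[of "Q * A" m n] frob_norm_sq_col[OF assms(2)] assms(1,2) by simp
qed

text \<open>A factor on the right changes the Gram matrix, and the quaternion trace is not cyclic.
  Passing to adjoints moves the factor to the left, where the Gram argument applies.\<close>

lemma frob_norm_mult_coisometry:
  assumes "A \<in> carrier_mat m p" "Q \<in> carrier_mat p n" "Q * qadjoint Q = 1\<^sub>m p"
  shows "(frob_norm (A * Q))\<^sup>2 = (frob_norm A)\<^sup>2"
proof -
  have "(frob_norm (A * Q))\<^sup>2 = (frob_norm (qadjoint Q * qadjoint A))\<^sup>2"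
    using frob_norm_qadjoint[of "A * Q" m n] assms qadjoint_mult[OF assms(1,2)] by simp
  also have "\<dots> = (frob_norm (qadjoint A))\<^sup>2"
    using frob_norm_isometry_mult[OF qadjoint_carrier[OF assms(2)] qadjoint_carrier[OF assms(1)]]
      assms(3) by simp
  also have "\<dots> = (frob_norm A)\<^sup>2" by (rule frob_norm_qadjoint[OF assms(1)])
  finally show ?thesis .
qed

text \<open>
  Over a field this follows from determinants. Here, \<open>1 - W W\<^sup>*\<close> is an orthogonal projection whose
  trace has real part \<open>n - \<parallel>W\<parallel>\<^sup>2 = 0\<close>, and that real part is the square of its Frobenius norm.
\<close>

lemma qadjoint_left_inverse_imp_right_inverse:
  assumes W: "W \<in> carrier_mat n n" and WW: "qadjoint W * W = 1\<^sub>m n"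
  shows "W * qadjoint W = 1\<^sub>m n"
proof -
  define P where "P = W * qadjoint W"
  define R where "R = 1\<^sub>m n - P"
  note W' = qadjoint_carrier[OF W]
  have P: "P \<in> carrier_mat n n" using W W' by (simp add: P_def)
  have R: "R \<in> carrier_mat n n" using P by (simp add: R_def minus_carrier_mat)
  have PH: "qadjoint P = P" unfolding P_def by (simp add: qadjoint_mult[OF W W'])
  have "P * P = W * (qadjoint W * (W * qadjoint W))"
    unfolding P_def by (rule assoc_mult_mat[OF W W']) (use W W' in auto)
  also have "qadjoint W * (W * qadjoint W) = qadjoint W * W * qadjoint W"
    by (rule assoc_mult_mat[OF W' W W', symmetric])
  finally have PP: "P * P = P"
    using left_mult_one_mat[OF W'] by (simp add: WW P_def)
  have RH: "qadjoint R = R"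
  proof (rule eq_matI)
    fix i j assume "i < dim_row R" "j < dim_col R"
    then have ij: "i < n" "j < n" using R by auto
    have "P $$ (i, j) = conjugate (P $$ (j, i))"
      using PH P ij qadjoint_index[of i P j] by auto
    then show "qadjoint R $$ (i, j) = R $$ (i, j)"
      using ij R P by (auto simp: R_def conjugate_quat_minus)
  qed (use R in auto)
  have "R * R = 1\<^sub>m n * R - P * R"
    using minus_mult_distrib_mat[OF one_carrier_mat P R] by (simp add: R_def)
  also have "P * R = P * 1\<^sub>m n - P * P"
    using mult_minus_distrib_mat[OF P one_carrier_mat P] by (simp add: R_def)
  also have "\<dots> = 0\<^sub>m n n" using P by (simp add: PP minus_r_inv_mat)
  also have "1\<^sub>m n * R - 0\<^sub>m n n = R" using R by auto
  finally have RR: "R * R = R" .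
  \<comment> \<open>The real trace of \<open>W * qadjoint W\<close> is compared with that of
    \<open>qadjoint W * W\<close> through the norm: they are the squared norms of
    \<open>qadjoint W\<close> and of \<open>W\<close>.\<close>
  have "(\<Sum>i<n. qre (P $$ (i, i))) = (frob_norm (qadjoint W))\<^sup>2"
    using frob_norm_sq_col[OF W'] by (simp add: P_def)
  also have "\<dots> = (\<Sum>i<n. qre ((1\<^sub>m n :: quat mat) $$ (i, i)))"
    unfolding frob_norm_qadjoint[OF W] frob_norm_sq_col[OF W] WW ..
  finally have tr: "(\<Sum>i<n. qre (P $$ (i, i))) = real n" by simp
  have "(frob_norm R)\<^sup>2 = (\<Sum>i<n. qre (R $$ (i, i)))"
    using frob_norm_sq_col[OF R] by (simp only: RH RR)
  also have "\<dots> = (\<Sum>i<n. 1 - qre (P $$ (i, i)))"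
    by (intro sum.cong refl) (use P in \<open>auto simp: R_def\<close>)
  also have "\<dots> = 0" using tr by (simp add: sum_subtractf)
  finally have 0: "(\<Sum>i<n. \<Sum>j<n. (norm (R $$ (i, j)))\<^sup>2) = 0"
    unfolding frob_norm_sq[OF R] .
  have "R $$ (i, j) = 0" if "i < n" "j < n" for i j
  proof -
    have "(\<Sum>j<n. (norm (R $$ (i, j)))\<^sup>2) = 0"
      using 0 that by (subst (asm) sum_nonneg_eq_0_iff) (auto intro: sum_nonneg)
    then show ?thesis using that by (subst (asm) sum_nonneg_eq_0_iff) auto
  qed
  then show ?thesis
    using P by (intro eq_matI) (auto simp: R_def P_def[symmetric])
qed


section \<open>Uniqueness of the singular values\<close>

lemma qunitary_qadjoint_mult:
  assumes "qunitary n V" "qunitary n V'"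
  shows "qunitary n (qadjoint V * V')"
proof -
  have c: "V \<in> carrier_mat n n" "V' \<in> carrier_mat n n"
    "qadjoint V \<in> carrier_mat n n" "qadjoint V' \<in> carrier_mat n n"
    using assms by (auto simp: qunitary_def)
  have 1: "qadjoint (qadjoint V * V') * (qadjoint V * V') = 1\<^sub>m n"
  proof -
    have "qadjoint (qadjoint V * V') * (qadjoint V * V') = qadjoint V' * V * (qadjoint V * V')"
      by (simp add: qadjoint_mult[OF c(3,2)])
    also have "\<dots> = qadjoint V' * (V * (qadjoint V * V'))"
      by (rule assoc_mult_mat[OF c(4,1)]) (use c in auto)
    also have "V * (qadjoint V * V') = V * qadjoint V * V'"
      by (rule assoc_mult_mat[OF c(1,3,2), symmetric])
    also have "\<dots> = V'"
      using assms left_mult_one_mat[OF c(2)] by (simp add: qunitary_def)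
    finally show ?thesis using assms by (simp add: qunitary_def)
  qed
  moreover have "qadjoint V * V' \<in> carrier_mat n n" by (rule mult_carrier_mat[OF c(3,2)])
  ultimately show ?thesis
    using qadjoint_left_inverse_imp_right_inverse by (auto simp: qunitary_def)
qed

lemma qunitary_row_col_sums:
  assumes "qunitary n Q"
  shows "k < n \<Longrightarrow> (\<Sum>l<n. (norm (Q $$ (k, l)))\<^sup>2) = 1"
    and "l < n \<Longrightarrow> (\<Sum>k<n. (norm (Q $$ (k, l)))\<^sup>2) = 1"
proof -
  have Q: "Q \<in> carrier_mat n n" and Q': "qadjoint Q \<in> carrier_mat n n"
    and 1: "qadjoint Q * Q = 1\<^sub>m n" "Q * qadjoint Q = 1\<^sub>m n"
    using assms by (auto simp: qunitary_def)
  show "(\<Sum>l<n. (norm (Q $$ (k, l)))\<^sup>2) = 1" if "k < n"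
  proof -
    have "(\<Sum>l<n. (norm (Q $$ (k, l)))\<^sup>2) = qre (\<Sum>l<n. Q $$ (k, l) * qadjoint Q $$ (l, k))"
      unfolding qre_sum using Q that by (intro sum.cong) (auto simp: qre_conjugate_mult)
    also have "\<dots> = qre ((Q * qadjoint Q) $$ (k, k))"
      using mult_mat_index_sum[OF Q Q' that that] by simp
    finally show ?thesis using that by (simp add: 1)
  qed
  show "(\<Sum>k<n. (norm (Q $$ (k, l)))\<^sup>2) = 1" if "l < n"
  proof -
    have "(\<Sum>k<n. (norm (Q $$ (k, l)))\<^sup>2) = qre (\<Sum>k<n. qadjoint Q $$ (l, k) * Q $$ (k, l))"
      unfolding qre_sum using Q that by (intro sum.cong) (auto simp: qre_conjugate_mult)
    also have "\<dots> = qre ((qadjoint Q * Q) $$ (l, l))"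
      using mult_mat_index_sum[OF Q' Q that that] by simp
    finally show ?thesis using that by (simp add: 1)
  qed
qed

text \<open>Each row in \<open>?K\<close> has its whole unit mass inside the columns
  \<open>?L\<close>, and each column in \<open>?L\<close> inside the rows \<open>?K\<close>. The
  total mass of the block thus counts both sets.\<close>

lemma qunitary_block_card:
  assumes Q: "qunitary n Q"
    and ab: "\<And>k l. k < n \<Longrightarrow> l < n \<Longrightarrow> Q $$ (k, l) \<noteq> 0 \<Longrightarrow> a k = b l"
  shows "card {k. k < n \<and> a k = c} = card {l. l < n \<and> b l = c}" (is "card ?K = card ?L")
proof -
  let ?q = "\<lambda>k l. (norm (Q $$ (k, l)))\<^sup>2"
  have "real (card ?K) = (\<Sum>k\<in>?K. \<Sum>l<n. ?q k l)"
    using qunitary_row_col_sums(1)[OF Q] by simp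
  also have "\<dots> = (\<Sum>k\<in>?K. \<Sum>l\<in>?L. ?q k l)"
    by (rule sum.cong[OF refl], rule sum.mono_neutral_right) (use ab in auto)
  also have "\<dots> = (\<Sum>l\<in>?L. \<Sum>k\<in>?K. ?q k l)" by (rule sum.swap)
  also have "\<dots> = (\<Sum>l\<in>?L. \<Sum>k<n. ?q k l)"
    by (rule sum.cong[OF refl], rule sum.mono_neutral_left) (use ab in auto)
  also have "\<dots> = real (card ?L)"
    using qunitary_row_col_sums(2)[OF Q] by simp
  finally show ?thesis by simp
qed

section \<open>Diagonal factors and the Gram matrix of a decomposition\<close>

text \<open>This is the diagonal factor inside \<open>qsvd\<close>, given a name so that it can be
  folded there. It may be rectangular; matrix indices start at 0, those of \<sigma> at 1.\<close>

definition qdiag :: "nat \<Rightarrow> nat \<Rightarrow> (nat \<Rightarrow> real) \<Rightarrow> quat mat" where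
  "qdiag m n \<sigma> = mat m n (\<lambda>(i, j). if i = j then of_real (\<sigma> (i + 1)) else 0)"

lemma qdiag_carrier [simp, intro]: "qdiag m n \<sigma> \<in> carrier_mat m n"
  by (simp add: qdiag_def)

lemma dim_qdiag [simp]: "dim_row (qdiag m n \<sigma>) = m" "dim_col (qdiag m n \<sigma>) = n"
  by (simp_all add: qdiag_def)

lemma qdiag_mult_index:
  assumes "A \<in> carrier_mat n p" "k < m" "l < p" "k < n"
  shows "(qdiag m n \<sigma> * A) $$ (k, l) = of_real (\<sigma> (k + 1)) * A $$ (k, l)"
proof -
  have "(qdiag m n \<sigma> * A) $$ (k, l) = (\<Sum>x<n. qdiag m n \<sigma> $$ (k, x) * A $$ (x, l))"
    using assms by (intro mult_mat_index_sum) auto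
  also have "\<dots> = (\<Sum>x<n. if x = k then of_real (\<sigma> (k + 1)) * A $$ (k, l) else 0)"
    using assms by (intro sum.cong) (auto simp: qdiag_def)
  finally show ?thesis using assms by simp
qed

lemma qdiag_mult_index_0:
  assumes "A \<in> carrier_mat n p" "k < m" "l < p" "n \<le> k"
  shows "(qdiag m n \<sigma> * A) $$ (k, l) = 0"
proof -
  have "(qdiag m n \<sigma> * A) $$ (k, l) = (\<Sum>x<n. qdiag m n \<sigma> $$ (k, x) * A $$ (x, l))"
    using assms by (intro mult_mat_index_sum) auto
  also have "\<dots> = 0"
    using assms by (intro sum.neutral) (auto simp: qdiag_def)
  finally show ?thesis .
qed

lemma mult_qdiag_index:
  assumes "A \<in> carrier_mat p n" "k < p" "l < n"
  shows "(A * qdiag n n \<sigma>) $$ (k, l) = A $$ (k, l) * of_real (\<sigma> (l + 1))"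
proof -
  have "(A * qdiag n n \<sigma>) $$ (k, l) = (\<Sum>x<n. A $$ (k, x) * qdiag n n \<sigma> $$ (x, l))"
    using assms by (intro mult_mat_index_sum) auto
  also have "\<dots> = (\<Sum>x<n. if x = l then A $$ (k, l) * of_real (\<sigma> (l + 1)) else 0)"
    using assms by (intro sum.cong) (auto simp: qdiag_def)
  finally show ?thesis using assms by simp
qed

lemma qsvdD:
  assumes "qsvd A U \<sigma> V" "A \<in> carrier_mat m n"
  shows "qunitary m U" "qunitary n V" "A = U * qdiag m n \<sigma> * qadjoint V"
    "\<And>k l. k \<in> {1..n} \<Longrightarrow> l \<in> {1..n} \<Longrightarrow> k \<le> l \<Longrightarrow> \<sigma> l \<le> \<sigma> k"
    "\<And>k. k \<in> {1..n} \<Longrightarrow> 0 \<le> \<sigma> k"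
    "\<And>k. k \<in> {1..n} \<Longrightarrow> m < k \<Longrightarrow> \<sigma> k = 0"
proof -
  have d: "dim_row A = m" "dim_col A = n" using assms(2) by auto
  note svd = assms(1)[unfolded qsvd_def Let_def d, folded qdiag_def]
  show "qunitary m U" "qunitary n V" "A = U * qdiag m n \<sigma> * qadjoint V"
    using svd by blast+
  show "\<And>k l. k \<in> {1..n} \<Longrightarrow> l \<in> {1..n} \<Longrightarrow> k \<le> l \<Longrightarrow> \<sigma> l \<le> \<sigma> k"
    "\<And>k. k \<in> {1..n} \<Longrightarrow> 0 \<le> \<sigma> k"
    "\<And>k. k \<in> {1..n} \<Longrightarrow> m < k \<Longrightarrow> \<sigma> k = 0"
    using svd by blast+
qed

text \<open>The factor \<open>U\<close> cancels in the Gram matrix, which leaves the eigenvector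
  equation for the columns of \<open>V\<close>. The diagonal factor stands on the right, as for
  right eigenvectors.\<close>

lemma qsvd_gram:
  assumes "qsvd A U \<sigma> V" and A: "A \<in> carrier_mat m n"
  shows "qadjoint A * A * V = V * qdiag n n (\<lambda>k. (\<sigma> k)\<^sup>2)"
proof -
  note svd = qsvdD[OF assms]
  let ?S = "qdiag m n \<sigma>"
  have c: "U \<in> carrier_mat m m" "qadjoint U \<in> carrier_mat m m"
    "V \<in> carrier_mat n n" "qadjoint V \<in> carrier_mat n n"
    "?S \<in> carrier_mat m n" "qadjoint ?S \<in> carrier_mat n m" "U * ?S \<in> carrier_mat m n"
    "qadjoint A \<in> carrier_mat n m"
    using svd(1,2) A by (auto simp: qunitary_def)
  have UV: "qadjoint U * U = 1\<^sub>m m" "qadjoint V * V = 1\<^sub>m n"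
    using svd(1,2) by (auto simp: qunitary_def)
  have AV: "A * V = U * ?S"
  proof -
    have "A * V = U * ?S * (qadjoint V * V)"
      unfolding svd(3) by (rule assoc_mult_mat[OF c(7,4,3)])
    then show ?thesis using right_mult_one_mat[OF c(7)] by (simp add: UV)
  qed
  have adj: "qadjoint A = V * (qadjoint ?S * qadjoint U)"
    unfolding svd(3) by (simp add: qadjoint_mult[OF c(7,4)] qadjoint_mult[OF c(1,5)])
  have "qadjoint A * A * V = V * (qadjoint ?S * qadjoint U) * (U * ?S)"
    using assoc_mult_mat[OF c(8) A c(3)] by (simp add: AV adj)
  also have "\<dots> = V * (qadjoint ?S * qadjoint U * (U * ?S))"
    by (rule assoc_mult_mat[OF c(3) mult_carrier_mat[OF c(6,2)] c(7)])
  also have "qadjoint ?S * qadjoint U * (U * ?S) = qadjoint ?S * (qadjoint U * (U * ?S))"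
    by (rule assoc_mult_mat[OF c(6,2,7)])
  also have "qadjoint U * (U * ?S) = qadjoint U * U * ?S"
    by (rule assoc_mult_mat[OF c(2,1,5), symmetric])
  also have "\<dots> = ?S" using left_mult_one_mat[OF c(5)] by (simp add: UV)
  also have "qadjoint ?S * ?S = qdiag n n (\<lambda>k. (\<sigma> k)\<^sup>2)"
  proof (rule eq_matI)
    fix k l assume "k < dim_row (qdiag n n (\<lambda>k. (\<sigma> k)\<^sup>2))" "l < dim_col (qdiag n n (\<lambda>k. (\<sigma> k)\<^sup>2))"
    then have kl: "k < n" "l < n" by (auto simp: qdiag_def)
    have "(qadjoint ?S * ?S) $$ (k, l) = (\<Sum>x<m. qadjoint ?S $$ (k, x) * ?S $$ (x, l))"
      using c kl by (intro mult_mat_index_sum) auto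
    also have "\<dots> = (\<Sum>x<m. if x = k then (if k = l then of_real ((\<sigma> (k + 1))\<^sup>2) else 0) else 0)"
      using kl c(5) by (intro sum.cong) (auto simp: qdiag_def power2_eq_square)
    \<comment> \<open>For \<open>m \<le> k\<close> the sum contains no index \<open>x = k\<close>
      and vanishes; the convention that \<sigma> is 0 beyond \<open>m\<close> makes the diagonal
      entry vanish too.\<close>
    also have "\<dots> = qdiag n n (\<lambda>k. (\<sigma> k)\<^sup>2) $$ (k, l)"
      using kl svd(6)[of "k + 1"] by (auto simp: qdiag_def)
    finally show "(qadjoint ?S * ?S) $$ (k, l) = qdiag n n (\<lambda>k. (\<sigma> k)\<^sup>2) $$ (k, l)" .
  qed (use c in auto)
  finally show ?thesis .
qed

text \<open>The change of basis \<open>Q\<close> between the two eigenbases of the same Gram matrix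
  intertwines the two diagonal matrices, so a nonzero entry of \<open>Q\<close> forces the
  corresponding values to agree.\<close>

lemma qsvd_multiplicity_unique:
  assumes s: "qsvd A U \<sigma> V" and s': "qsvd A U' \<sigma>' V'" and A: "A \<in> carrier_mat m n"
  shows "card {k. k < n \<and> \<sigma> (k + 1) = c} = card {k. k < n \<and> \<sigma>' (k + 1) = c}"
proof (rule qunitary_block_card)
  note svd = qsvdD[OF s A] and svd' = qsvdD[OF s' A]
  define Q where "Q = qadjoint V * V'"
  let ?D = "qdiag n n (\<lambda>k. (\<sigma> k)\<^sup>2)" and ?D' = "qdiag n n (\<lambda>k. (\<sigma>' k)\<^sup>2)" and ?G = "qadjoint A * A"
  show "qunitary n (qadjoint V * V')" by (rule qunitary_qadjoint_mult[OF svd(2) svd'(2)])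
  have c: "V \<in> carrier_mat n n" "V' \<in> carrier_mat n n" "qadjoint V \<in> carrier_mat n n"
     "?G \<in> carrier_mat n n" "Q \<in> carrier_mat n n" "?D \<in> carrier_mat n n" "?D' \<in> carrier_mat n n"
    using svd(2) svd'(2) A by (auto simp: qunitary_def Q_def)
  have GH: "qadjoint ?G = ?G"
    using qadjoint_mult[OF qadjoint_carrier[OF A] A] by simp
  have DH: "qadjoint ?D = ?D"
    by (rule eq_matI) (auto simp: qdiag_def simp del: of_real_power)
  have "Q * ?D' = qadjoint V * (V' * ?D')"
    unfolding Q_def by (rule assoc_mult_mat[OF c(3,2,7)])
  also have "\<dots> = qadjoint V * (?G * V')" using qsvd_gram[OF s' A] by simp
  also have "\<dots> = qadjoint V * ?G * V'" by (rule assoc_mult_mat[OF c(3,4,2), symmetric])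
  \<comment> \<open>As \<open>?G\<close> and \<open>?D\<close> are self-adjoint, the adjoint of the
    eigenvector equation for \<open>V\<close> moves \<open>?D\<close> to the left.\<close>
  also have "qadjoint V * ?G = qadjoint (?G * V)" by (simp only: qadjoint_mult[OF c(4,1)] GH)
  also have "\<dots> = ?D * qadjoint V"
    by (simp only: qsvd_gram[OF s A] qadjoint_mult[OF c(1,6)] DH)
  also have "?D * qadjoint V * V' = ?D * Q"
    unfolding Q_def by (rule assoc_mult_mat[OF c(6,3,2)])
  finally have QD: "Q * ?D' = ?D * Q" .
  fix k l assume kl: "k < n" "l < n" "(qadjoint V * V') $$ (k, l) \<noteq> 0"
  let ?q = "Q $$ (k, l)"
  have q: "?q \<noteq> 0" using kl(3) unfolding Q_def .
  have "?q * of_real ((\<sigma>' (l + 1))\<^sup>2) = of_real ((\<sigma> (k + 1))\<^sup>2) * ?q"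
    using mult_qdiag_index[OF c(5) kl(1,2)] qdiag_mult_index[OF c(5) kl(1,2,1)] QD by metis
  \<comment> \<open>Quaternions do not commute, but the squared singular values are real and hence
    central, so both sides become real multiples of the nonzero \<open>?q\<close>.\<close>
  then have "(\<sigma>' (l + 1))\<^sup>2 *\<^sub>R ?q = (\<sigma> (k + 1))\<^sup>2 *\<^sub>R ?q"
    by (simp only: of_real_def mult_scaleR_left mult_scaleR_right mult_1_left mult_1_right)
  then have "(\<sigma> (k + 1))\<^sup>2 = (\<sigma>' (l + 1))\<^sup>2" using q by simp
  then show "\<sigma> (k + 1) = \<sigma>' (l + 1)"
    using svd(5)[of "k + 1"] svd'(5)[of "l + 1"] kl by (simp add: power2_eq_iff_nonneg)
qed

section \<open>The multiset of singular values and the \<delta>-rank\<close>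

lemma count_image_mset_atLeastAtMost:
  fixes n :: nat
  shows "count (image_mset \<sigma> (mset_set {1..n})) c = card {k. k < n \<and> \<sigma> (k + 1) = c}"
proof -
  have "count (image_mset \<sigma> (mset_set {1..n})) c =
      (\<Sum>k\<in>{k \<in> {1..n}. \<sigma> k = c}. count (mset_set {1..n}) k)"
    unfolding count_image_mset by (rule sum.cong) auto
  also have "\<dots> = (\<Sum>k\<in>{k \<in> {1..n}. \<sigma> k = c}. 1)"
    by (rule sum.cong) auto
  also have "\<dots> = card {k \<in> {1..n}. \<sigma> k = c}" by simp
  also have "{k \<in> {1..n}. \<sigma> k = c} = Suc ` {k. k < n \<and> \<sigma> (k + 1) = c}"
    by (auto simp: image_iff gr0_conv_Suc Suc_le_eq)
  finally show ?thesis by (simp add: card_image)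
qed

text \<open>A decomposition lists \<open>n\<close> values, \<open>singular_values\<close> only
  \<open>min m n\<close> of them. The surplus consists of zeros whose number depends on the shape
  alone, so it cancels when two decompositions are compared.\<close>

lemma qsvd_image_mset_padding:
  assumes "qsvd A U \<sigma> V" "A \<in> carrier_mat m n"
  shows "image_mset \<sigma> (mset_set {1..n}) =
    image_mset \<sigma> (mset_set {1..min m n}) + replicate_mset (n - m) 0"
proof -
  have "{1..n} = {1..min m n} \<union> {m + 1..n}" by auto
  also have "mset_set \<dots> = mset_set {1..min m n} + mset_set {m + 1..n}"
    by (rule mset_set_Union) auto
  finally have "mset_set {1..n} = mset_set {1..min m n} + mset_set {m + 1..n}" .
  moreover have "image_mset \<sigma> (mset_set {m + 1..n}) = image_mset (\<lambda>_. 0) (mset_set {m + 1..n})"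
    using qsvdD(6)[OF assms] by (intro image_mset_cong) auto
  ultimately show ?thesis by (simp add: image_mset_const_eq)
qed

text \<open>This resolves the definite description: the given decomposition is a witness, and equal
  multiplicities give uniqueness.\<close>

lemma singular_values_eq:
  assumes s: "qsvd A U \<sigma> V" and A: "A \<in> carrier_mat m n"
  shows "singular_values A = image_mset \<sigma> (mset_set {1..min m n})"
  unfolding singular_values_def
proof (rule the_equality)
  have d: "dim_row A = m" "dim_col A = n" using A by auto
  show "\<exists>U \<sigma>' V. qsvd A U \<sigma>' V \<and> image_mset \<sigma> (mset_set {1..min m n}) =
      image_mset \<sigma>' (mset_set {1..min (dim_row A) (dim_col A)})"
    using s unfolding d by blast
  fix S assume "\<exists>U \<sigma>' V. qsvd A U \<sigma>' V \<and>
      S = image_mset \<sigma>' (mset_set {1..min (dim_row A) (dim_col A)})"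
  then obtain U' \<sigma>' V' where s': "qsvd A U' \<sigma>' V'"
    and S: "S = image_mset \<sigma>' (mset_set {1..min m n})" unfolding d by blast
  have "image_mset \<sigma> (mset_set {1..n}) = image_mset \<sigma>' (mset_set {1..n})"
    by (rule multiset_eqI)
       (simp only: count_image_mset_atLeastAtMost qsvd_multiplicity_unique[OF s s' A])
  then show "S = image_mset \<sigma> (mset_set {1..min m n})"
    unfolding S qsvd_image_mset_padding[OF s A] qsvd_image_mset_padding[OF s' A] by simp
qed

text \<open>The values decrease, so every value exceeding \<delta> has an index below
  \<open>r\<close>.\<close>

lemma delta_rank_less:
  assumes s: "qsvd A U \<sigma> V" and A: "A \<in> carrier_mat m n"
    and r: "r \<in> {1..n}" and le: "\<sigma> r \<le> \<delta>"
  shows "delta_rank \<delta> A < r"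
proof -
  have "delta_rank \<delta> A = card {k \<in> {1..min m n}. \<delta> < \<sigma> k}"
    by (simp add: delta_rank_def singular_values_eq[OF s A] filter_mset_image_mset)
  also have "\<dots> \<le> card {1..<r}"
  proof (intro card_mono subsetI)
    fix k assume "k \<in> {k \<in> {1..min m n}. \<delta> < \<sigma> k}"
    then show "k \<in> {1..<r}"
      using qsvdD(4)[OF s A, of r k] r le by (cases "r \<le> k") auto
  qed simp
  finally show ?thesis using r by auto
qed


section \<open>Distances within a class\<close>

text \<open>Stacking columns puts entry \<open>(i, j)\<close> at position \<open>i + j * w\<close>;
  the sum is cut into \<open>h\<close> blocks of length \<open>w\<close>, one for each
  column.\<close>

lemma sum_vectorize:
  fixes g :: "nat \<Rightarrow> nat \<Rightarrow> real"
  shows "(\<Sum>a<w * h. g (a mod w) (a div w)) = (\<Sum>i<w. \<Sum>j<h. g i j)"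
proof -
  have "(\<Sum>a<w * h. g (a mod w) (a div w)) = (\<Sum>j<h. \<Sum>a = j * w..<j * w + w. g (a mod w) (a div w))"
    by (subst sum.nat_group) (simp only: mult.commute)
  also have "\<dots> = (\<Sum>j<h. \<Sum>i<w. g i j)"
  proof (rule sum.cong[OF refl])
    fix j
    have "(\<Sum>a = j * w..<j * w + w. g (a mod w) (a div w)) =
        (\<Sum>i = 0..<w. g ((i + j * w) mod w) ((i + j * w) div w))"
      using sum.shift_bounds_nat_ivl[of "\<lambda>a. g (a mod w) (a div w)" 0 "j * w" w]
      by (simp only: add_0 add.commute[of w])
    also have "\<dots> = (\<Sum>i<w. g i j)"
      by (rule sum.cong) auto
    finally show "(\<Sum>a = j * w..<j * w + w. g (a mod w) (a div w)) = (\<Sum>i<w. g i j)" .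
  qed
  also have "\<dots> = (\<Sum>i<w. \<Sum>j<h. g i j)" by (rule sum.swap)
  finally show ?thesis .
qed

text \<open>Entrywise, this is the triangle inequality followed by
  \<open>2 * x * y \<le> x\<^sup>2 + y\<^sup>2\<close>. Nothing is lost in the application, where
  both distances have the same bound.\<close>

lemma frob_norm_diff_sq_le:
  assumes "A \<in> carrier_mat m n" "B \<in> carrier_mat m n" "C \<in> carrier_mat m n"
  shows "(frob_norm (A - B))\<^sup>2 \<le> 2 * (frob_norm (A - C))\<^sup>2 + 2 * (frob_norm (B - C))\<^sup>2"
proof -
  have ineq: "(norm (a - b))\<^sup>2 \<le> 2 * (norm (a - c))\<^sup>2 + 2 * (norm (b - c))\<^sup>2" for a b c :: quat
  proof -
    have "norm (a - b) \<le> norm (a - c) + norm (b - c)"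
      by (metis dist_norm dist_triangle2)
    then have "(norm (a - b))\<^sup>2 \<le> (norm (a - c) + norm (b - c))\<^sup>2" by (intro power_mono) auto
    also have "\<dots> \<le> 2 * (norm (a - c))\<^sup>2 + 2 * (norm (b - c))\<^sup>2"
      using sum_squares_bound[of "norm (a - c)" "norm (b - c)"] by (simp add: power2_sum)
    finally show ?thesis .
  qed
  have eq: "(frob_norm (X - Z))\<^sup>2 = (\<Sum>i<m. \<Sum>j<n. (norm (X $$ (i, j) - Z $$ (i, j)))\<^sup>2)"
    if "X \<in> carrier_mat m n" "Z \<in> carrier_mat m n" for X Z
    using that by (subst frob_norm_sq[of _ m n]) (auto intro!: sum.cong)
  show ?thesis
    unfolding eq[OF assms(1,2)] eq[OF assms(1,3)] eq[OF assms(2,3)] sum_distrib_left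
      sum.distrib[symmetric] by (intro sum_mono ineq)
qed

text \<open>The mean cancels in the difference, leaving right multiplication by \<open>W\<close>.
  Its invariance requires \<open>W * qadjoint W = 1\<^sub>m h\<close>, which follows from the
  orthonormality of the columns.\<close>

lemma frob_norm_projection_diff:
  assumes W: "W \<in> carrier_mat h h" "qadjoint W * W = 1\<^sub>m h"
    and A: "A \<in> carrier_mat w h" and B: "B \<in> carrier_mat w h"
  shows "(frob_norm (projection w h L E W A - projection w h L E W B))\<^sup>2 = (frob_norm (A - B))\<^sup>2"
proof -
  define M where "M = exemplar_mean w h L E"
  have M: "M \<in> carrier_mat w h" by (simp add: M_def exemplar_mean_def)
  have AM: "A - M \<in> carrier_mat w h" and BM: "B - M \<in> carrier_mat w h"
    and AB: "A - B \<in> carrier_mat w h"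
    using M B by (auto intro: minus_carrier_mat)
  have "projection w h L E W A - projection w h L E W B = (A - M - (B - M)) * W"
    unfolding projection_def M_def[symmetric]
    by (rule minus_mult_distrib_mat[OF AM BM W(1), symmetric])
  also have "A - M - (B - M) = A - B" using A B M by (intro eq_matI) auto
  finally show ?thesis
    using frob_norm_mult_coisometry[OF AB W(1) qadjoint_left_inverse_imp_right_inverse[OF W]]
    by simp
qed

text \<open>A difference of columns is a product with a difference of two unit vectors. The isometry
  \<open>qadjoint V\<close> sends the latter to \<open>v\<close>, and \<open>U\<close> preserves the
  norm of the diagonal factor applied to \<open>v\<close>.\<close>

lemma qsvd_col_diff:
  assumes s: "qsvd F U \<sigma> V" and F: "F \<in> carrier_mat m d"
    and i: "i \<in> {1..d}" and j: "j \<in> {1..d}" and ij: "i \<noteq> j"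
  defines "v \<equiv> difference_vec V i j"
  shows "(\<Sum>k = 1..d. (norm (v $ (k - 1)))\<^sup>2) = 2"
    and "(\<Sum>k = 1..d. (\<sigma> k)\<^sup>2 * (norm (v $ (k - 1)))\<^sup>2) =
      (\<Sum>a<m. (norm (F $$ (a, i - 1) - F $$ (a, j - 1)))\<^sup>2)"
proof -
  note svd = qsvdD[OF s F]
  let ?S = "qdiag m d \<sigma>"
  \<comment> \<open>The difference of the two unit vectors, stored in \<open>Z\<close> as a
    one-column matrix so that the Frobenius norm lemmas apply to it.\<close>
  define z :: "nat \<Rightarrow> quat" where "z k = (if k = i - 1 then 1 else 0) - (if k = j - 1 then 1 else 0)" for k
  define Z :: "quat mat" where "Z = mat d 1 (\<lambda>(k, _). z k)"
  have c: "U \<in> carrier_mat m m" "V \<in> carrier_mat d d" "qadjoint V \<in> carrier_mat d d"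
    "?S \<in> carrier_mat m d" "U * ?S \<in> carrier_mat m d" "Z \<in> carrier_mat d 1"
    "qadjoint V * Z \<in> carrier_mat d 1" "F * Z \<in> carrier_mat m 1"
    using svd(1,2) F by (auto simp: qunitary_def Z_def)
  have SVZ: "?S * (qadjoint V * Z) \<in> carrier_mat m 1" by (rule mult_carrier_mat[OF c(4,7)])
  have UV: "qadjoint U * U = 1\<^sub>m m" "qadjoint (qadjoint V) * qadjoint V = 1\<^sub>m d"
    using svd(1,2) by (auto simp: qunitary_def)
  have ij': "i - 1 < d" "j - 1 < d" "i - 1 \<noteq> j - 1" using i j ij by auto
  have MZ: "(M * Z) $$ (a, 0) = M $$ (a, i - 1) - M $$ (a, j - 1)"
    if "M \<in> carrier_mat p d" "a < p" for M :: "quat mat" and p a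
  proof -
    have "(M * Z) $$ (a, 0) = (\<Sum>k<d. M $$ (a, k) * Z $$ (k, 0))"
      by (rule mult_mat_index_sum[OF that(1) c(6) that(2)]) simp
    also have "\<dots> = (\<Sum>k<d. (if k = i - 1 then M $$ (a, k) else 0) -
        (if k = j - 1 then M $$ (a, k) else 0))"
      by (intro sum.cong) (auto simp: Z_def z_def)
    finally show ?thesis using ij' by (simp add: sum_subtractf)
  qed
  have v: "(qadjoint V * Z) $$ (k, 0) = v $ k" if "k < d" for k
    unfolding MZ[OF c(3) that] using that ij' c(2)
    by (simp add: v_def difference_vec_def)
  have one: "(frob_norm X)\<^sup>2 = (\<Sum>k<p. (norm (X $$ (k, 0)))\<^sup>2)"
    if "X \<in> carrier_mat p 1" for X p
    using frob_norm_sq[OF that] by simp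
  have shift: "(\<Sum>k = 1..d. f k) = (\<Sum>k<d. f (Suc k))" for f :: "nat \<Rightarrow> real"
    by (simp add: sum.atLeast1_atMost_eq)
  have "(\<Sum>k = 1..d. (norm (v $ (k - 1)))\<^sup>2) = (frob_norm (qadjoint V * Z))\<^sup>2"
    unfolding shift one[OF c(7)] by (intro sum.cong) (auto simp: v simp del: index_mult_mat(1))
  also have "\<dots> = (frob_norm Z)\<^sup>2"
    by (rule frob_norm_isometry_mult[OF c(3,6) UV(2)])
  also have "\<dots> = (\<Sum>k<d. (if k = i - 1 then 1 else 0) + (if k = j - 1 then 1 else 0))"
    unfolding one[OF c(6)] using ij' by (intro sum.cong) (auto simp: Z_def z_def)
  also have "\<dots> = 2" using ij' by (simp add: sum.distrib)
  finally show "(\<Sum>k = 1..d. (norm (v $ (k - 1)))\<^sup>2) = 2" .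
  have "F * Z = U * ?S * (qadjoint V * Z)"
    unfolding svd(3) by (rule assoc_mult_mat[OF c(5,3,6)])
  also have "\<dots> = U * (?S * (qadjoint V * Z))"
    by (rule assoc_mult_mat[OF c(1,4,7)])
  finally have "(frob_norm (F * Z))\<^sup>2 = (frob_norm (?S * (qadjoint V * Z)))\<^sup>2"
    using frob_norm_isometry_mult[OF c(1) SVZ UV(1)] by simp
  also have "\<dots> = (\<Sum>k<m. if k < d then (\<sigma> (k + 1))\<^sup>2 * (norm (v $ k))\<^sup>2 else 0)"
    unfolding one[OF SVZ]
    using qdiag_mult_index[OF c(7), of _ m 0 \<sigma>] qdiag_mult_index_0[OF c(7), of _ m 0 \<sigma>] v
    by (intro sum.cong) (auto simp: norm_mult power_mult_distrib simp del: index_mult_mat(1))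
  also have "\<dots> = (\<Sum>k\<in>{..<m} \<inter> {..<d}. (\<sigma> (k + 1))\<^sup>2 * (norm (v $ k))\<^sup>2)"
    by (subst sum.inter_restrict) (auto intro: sum.cong)
  \<comment> \<open>If \<open>m < d\<close>, the added terms vanish because the corresponding values
    of \<sigma> are 0.\<close>
  also have "\<dots> = (\<Sum>k<d. (\<sigma> (k + 1))\<^sup>2 * (norm (v $ k))\<^sup>2)"
  proof (rule sum.mono_neutral_left)
    have "\<sigma> (k + 1) = 0" if "k < d" "\<not> k < m" for k
      using svd(6)[of "k + 1"] that by simp
    then show "\<forall>k\<in>{..<d} - {..<m} \<inter> {..<d}. (\<sigma> (k + 1))\<^sup>2 * (norm (v $ k))\<^sup>2 = 0" by auto
  qed auto
  finally have "(\<Sum>k = 1..d. (\<sigma> k)\<^sup>2 * (norm (v $ (k - 1)))\<^sup>2) = (frob_norm (F * Z))\<^sup>2"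
    unfolding shift by simp
  also have "\<dots> = (\<Sum>a<m. (norm (F $$ (a, i - 1) - F $$ (a, j - 1)))\<^sup>2)"
    unfolding one[OF c(8)] by (intro sum.cong) (auto simp: MZ[OF F] simp del: index_mult_mat(1))
  finally show "(\<Sum>k = 1..d. (\<sigma> k)\<^sup>2 * (norm (v $ (k - 1)))\<^sup>2) =
      (\<Sum>a<m. (norm (F $$ (a, i - 1) - F $$ (a, j - 1)))\<^sup>2)" .
qed

section \<open>Consequences of the index condition\<close>

text \<open>With both sums on one side, the condition says that the weighted sum of
  \<open>(\<sigma> k)\<^sup>2 - (\<sigma> r)\<^sup>2\<close> over all \<open>k\<close> is
  nonnegative; the term at \<open>k = r\<close> is 0.\<close>

lemma index_condition_imp_sum_ge:
  assumes "index_condition \<sigma> v d r" "r \<in> {1..d}"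
  shows "(\<sigma> r)\<^sup>2 * (\<Sum>k = 1..d. (norm (v $ (k - 1)))\<^sup>2) \<le>
    (\<Sum>k = 1..d. (\<sigma> k)\<^sup>2 * (norm (v $ (k - 1)))\<^sup>2)"
proof -
  define f where "f k = ((\<sigma> k)\<^sup>2 - (\<sigma> r)\<^sup>2) * (norm (v $ (k - 1)))\<^sup>2" for k
  have "{1..d} = {1..r - 1} \<union> ({r} \<union> {r + 1..d})" using assms(2) by auto
  then have "sum f {1..d} = sum f {1..r - 1} + sum f ({r} \<union> {r + 1..d})"
    by (simp only:) (rule sum.union_disjoint; auto)
  also have "sum f ({r} \<union> {r + 1..d}) = sum f {r + 1..d}"
    by (simp add: f_def)
  also have "\<dots> = - (\<Sum>k = r + 1..d. ((\<sigma> r)\<^sup>2 - (\<sigma> k)\<^sup>2) * (norm (v $ (k - 1)))\<^sup>2)"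
    by (simp add: f_def sum_negf[symmetric] algebra_simps)
  finally have "0 \<le> sum f {1..d}"
    using assms(1) by (simp add: index_condition_def f_def)
  then show ?thesis
    by (simp add: f_def left_diff_distrib sum_subtractf sum_distrib_left)
qed

text \<open>At the last index the right-hand sum is empty and the left-hand terms are nonnegative.
  This supplies a candidate for the least index in the theorem.\<close>

lemma index_condition_last:
  assumes "\<And>k. k \<in> {1..d} \<Longrightarrow> 0 \<le> \<sigma> d \<and> \<sigma> d \<le> \<sigma> k"
  shows "index_condition \<sigma> v d d"
proof -
  have "0 \<le> (\<Sum>k = 1..d - 1. ((\<sigma> k)\<^sup>2 - (\<sigma> d)\<^sup>2) * (norm (v $ (k - 1)))\<^sup>2)"
  proof (rule sum_nonneg)
    fix k assume "k \<in> {1..d - 1}"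
    then have "(\<sigma> d)\<^sup>2 \<le> (\<sigma> k)\<^sup>2" using assms[of k] by (intro power_mono) auto
    then show "0 \<le> ((\<sigma> k)\<^sup>2 - (\<sigma> d)\<^sup>2) * (norm (v $ (k - 1)))\<^sup>2" by simp
  qed
  then show ?thesis by (simp add: index_condition_def)
qed

theorem mainTheorem4:
  fixes \<delta> :: real
    and w h n L s d i j r :: nat
    and \<G> :: "quat mat multiset"
    and E Y :: "nat \<Rightarrow> quat mat"
    and W F U V :: "quat mat"
    and y :: "nat \<Rightarrow> nat"
    and \<sigma> :: "nat \<Rightarrow> real"
  assumes "0 < \<delta>"
    and "classification_2dqpca w h n L \<G> E Y W y"
    and "s \<in> {1..L}"
    and "d = card (class_indices n L y s)"
    and "F = class_matrix w h n L Y y s"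
    and "\<forall>k\<in>class_indices n L y s.
           frob_norm (projection w h L E W (Y k) - projection w h L E W (E s)) \<le> sqrt 2 / 2 * \<delta>"
    and "qsvd F U \<sigma> V"
    and "i \<in> {1..d}" and "j \<in> {1..d}" and "i \<noteq> j"
    and "r = (LEAST q. q \<in> {1..d} \<and> index_condition \<sigma> (difference_vec V i j) d q)"
  shows "\<sigma> r \<le> \<delta> \<and> delta_rank \<delta> F < r"
proof -
  define ks where "ks = sorted_list_of_set (class_indices n L y s)"
  let ?v = "difference_vec V i j"
  have fin: "finite (class_indices n L y s)" by (simp add: class_indices_def)
  have ks: "length ks = d" "set ks = class_indices n L y s"
    using fin assms(4) by (simp_all add: ks_def)
  have F: "F \<in> carrier_mat (w * h) d"
    using ks(1) mat_of_cols_carrier(1)[of "w * h" "map (\<lambda>k. vectorize (Y k)) ks"]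
    by (simp add: assms(5) class_matrix_def ks_def[symmetric] del: mat_of_cols_carrier)
  have \<G>: "\<G> = image_mset E (mset_set {1..L}) + image_mset Y (mset_set {1..n - L})"
    and carr: "\<forall>A\<in>#\<G>. A \<in> carrier_mat w h"
    and W: "W \<in> carrier_mat h h" "qadjoint W * W = 1\<^sub>m h"
    using assms(2) by (auto simp: classification_2dqpca_def)
  have Es: "E s \<in> carrier_mat w h"
    using carr assms(3) unfolding \<G> by auto
  have Yk: "Y k \<in> carrier_mat w h" if "k \<in> class_indices n L y s" for k
    using carr that unfolding \<G> class_indices_def by auto
  have near: "(frob_norm (Y k - E s))\<^sup>2 \<le> \<delta>\<^sup>2 / 2" if k: "k \<in> class_indices n L y s" for k
  proof -
    have "(frob_norm (Y k - E s))\<^sup>2 =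
        (frob_norm (projection w h L E W (Y k) - projection w h L E W (E s)))\<^sup>2"
      by (rule frob_norm_projection_diff[OF W Yk[OF k] Es, symmetric])
    also have "\<dots> \<le> (sqrt 2 / 2 * \<delta>)\<^sup>2"
      using assms(6) k by (intro power_mono) (auto simp: frob_norm_def sum_nonneg)
    also have "\<dots> = \<delta>\<^sup>2 / 2" by (simp add: power_mult_distrib power_divide)
    finally show ?thesis .
  qed
  \<comment> \<open>The patches that form columns \<open>i\<close> and \<open>j\<close> of
    \<open>F\<close>; the list counts from 0.\<close>
  define a b where "a = ks ! (i - 1)" and "b = ks ! (j - 1)"
  have ij: "i - 1 < d" "j - 1 < d" using assms(8,9) by auto
  have ab: "a \<in> class_indices n L y s" "b \<in> class_indices n L y s"
    using ij ks by (metis a_def nth_mem, metis b_def nth_mem)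
  have entry: "F $$ (x, q) = Y (ks ! q) $$ (x mod w, x div w)" if "x < w * h" "q < d" for x q
  proof -
    have "Y (ks ! q) \<in> carrier_mat w h" using Yk ks that(2) nth_mem by metis
    then show ?thesis
      using that ks(1)
      by (simp add: assms(5) class_matrix_def ks_def[symmetric] mat_of_cols_index vectorize_def)
  qed
  have "(\<Sum>x<w * h. (norm (F $$ (x, i - 1) - F $$ (x, j - 1)))\<^sup>2) =
      (\<Sum>x<w * h. (norm (Y a $$ (x mod w, x div w) - Y b $$ (x mod w, x div w)))\<^sup>2)"
    using ij by (intro sum.cong) (auto simp: entry a_def b_def)
  also have "\<dots> = (\<Sum>p<w. \<Sum>q<h. (norm (Y a $$ (p, q) - Y b $$ (p, q)))\<^sup>2)"
    by (rule sum_vectorize)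
  also have "\<dots> = (frob_norm (Y a - Y b))\<^sup>2"
    using Yk[OF ab(1)] Yk[OF ab(2)]
    by (subst frob_norm_sq[of _ w h]) (auto intro!: sum.cong)
  also have "\<dots> \<le> 2 * (frob_norm (Y a - E s))\<^sup>2 + 2 * (frob_norm (Y b - E s))\<^sup>2"
    by (rule frob_norm_diff_sq_le[OF Yk[OF ab(1)] Yk[OF ab(2)] Es])
  also have "\<dots> \<le> 2 * \<delta>\<^sup>2" using near[OF ab(1)] near[OF ab(2)] by simp
  finally have dist: "(\<Sum>k = 1..d. (\<sigma> k)\<^sup>2 * (norm (?v $ (k - 1)))\<^sup>2) \<le> 2 * \<delta>\<^sup>2"
    by (simp only: qsvd_col_diff(2)[OF assms(7) F assms(8-10)])
  \<comment> \<open>Since \<open>i\<close> lies in \<open>{1..d}\<close>, \<open>d\<close> is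
    positive and satisfies the condition, so the least index exists and satisfies it as
    well.\<close>
  have "d \<in> {1..d} \<and> index_condition \<sigma> ?v d d"
    using assms(8) qsvdD(4,5)[OF assms(7) F] by (auto intro!: index_condition_last)
  then have r: "r \<in> {1..d} \<and> index_condition \<sigma> ?v d r"
    unfolding assms(11) by (rule LeastI)
  \<comment> \<open>The factor 2 on the left is the total weight of \<open>?v\<close>; it cancels
    against the 2 in the distance bound.\<close>
  have "(\<sigma> r)\<^sup>2 * 2 \<le> 2 * \<delta>\<^sup>2"
    using index_condition_imp_sum_ge[of \<sigma> ?v d r] r dist
      qsvd_col_diff(1)[OF assms(7) F assms(8-10)] by simp
  then have "\<sigma> r \<le> \<delta>" using assms(1) by (intro power2_le_imp_le[of "\<sigma> r" \<delta>]) auto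
  then show ?thesis using delta_rank_less[OF assms(7) F] r by blast
qed

end
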